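(* Let $X=\{-1,1\}^{\mathbb N}$ and let $A:X\to\mathbb R$ be a potential in the class $\mathcal E$. Then for every $y\in[-1,1]^{\mathbb N}$ and every $n\ge 1$ the probability measure $$\mu_n^y=\sum_{x_0,\dots,x_{n-1}=\pm1}\frac{\exp\big(S_n(A)([x|y]_n)\big)}{Z_n^y}\,\delta_{[x|y]_n},\qquad Z_n^y=\sum_{x_0,\dots,x_{n-1}=\pm1}\exp\big(S_n(A)([x|y]_n)\big),$$ satisfies the FKG (correlation) inequality: for all increasing functions $f,g$ depending only on the first $n$ coordinates $(x_0,\dots,x_{n-1})$, $$\int fg\,d\mu_n^y-\int f\,d\mu_n^y\int g\,d\mu_n^y\ \ge 0 .$$
   Context: $\mathbb N=\{0,1,2,\dots\}$, $X=\{-1,1\}^{\mathbb N}$ with the product topology, $\sigma$ is the left shift $(x_0,x_1,x_2,\dots)\mapsto(x_1,x_2,\dots)$ (also on $\mathbb R^{\mathbb N}$). Partial order: $x\succeq y$ iff $x_j\ge y_j$ for all $j$. A function $f:X\to\mathbb R$ is increasing if $x\succeq y$ implies $f(x)\ge f(y)$. A function depending only on the first $n$ coordinates is evaluated at $[x|y]_n$ through $(x_0,\dots,x_{n-1})\in\{-1,1\}^n$, so integrals against $\mu_n^y$ make sense even if $y\in[-1,1]^{\mathbb N}\setminus X$. Notation: $[x|y]_n=(x_0,\dots,x_{n-1},y_n,y_{n+1},\dots)$, $[x|t|y]_n=(x_0,\dots,x_{n-1},t,y_{n+1},y_{n+2},\dots)$, $S_n(A)=\sum_{k=0}^{n-1}A\circ\sigma^k$;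 $\delta_z$ is the Dirac mass at $z$. Differentiable extension: given $\varepsilon>0$, a function $\widetilde A:[-(1+\varepsilon),1+\varepsilon]^{\mathbb N}\to\mathbb R$ is a differentiable extension of $A:X\to\mathbb R$ if $\widetilde A=A$ on $X$ and, for all $j,n\in\mathbb N$, the partial derivatives below exist and for every fixed $x\in[-1,1]^{\mathbb N}$ the map $(-(1+\varepsilon),1+\varepsilon)\ni t\mapsto\frac{\partial\widetilde A}{\partial x_j}(x_0,\dots,x_{n-1},t,x_{n+1},\dots)$ is continuous. The extension is again denoted $A$. Class $\mathcal E$: a continuous $A:X\to\mathbb R$ belongs to $\mathcal E$ if it admits a differentiable extension (for some $\varepsilon>0$) such that for every fixed $t\in[-1,1]$, $y\in[-1,1]^{\mathbb N}$ and $n\ge1$ the map $X\ni x\mapsto\frac{d}{dt}S_n(A)([x|t|y]_n)$ is increasing. In the definition of $\mu_n^y$ and $Z_n^y$ this extension is used when $y\notin X$. *)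

theory Defs
  imports "HOL-Probability.Probability"
begin

text \<open>
  Sequences are functions \<open>nat \<Rightarrow> real\<close>; the library's order and topology on this type are the
  coordinatewise order and the product topology, so increasing functions are those with
  \<open>mono_on spin_space f\<close>. A function on a subset of the sequences is represented by a total
  function whose values elsewhere are irrelevant.
\<close>

definition spin_space :: "(nat \<Rightarrow> real) set" where
  "spin_space = {x. \<forall>i. x i \<in> {-1, 1}}"

definition cube :: "(nat \<Rightarrow> real) set" where
  "cube = {x. \<forall>i. x i \<in> {-1..1}}"

definition shift :: "(nat \<Rightarrow> real) \<Rightarrow> nat \<Rightarrow> real" where
  "shift x = (\<lambda>i. x (Suc i))"

definition birkhoff_sum :: "((nat \<Rightarrow> real) \<Rightarrow> real) \<Rightarrow> nat \<Rightarrow> (nat \<Rightarrow> real) \<Rightarrow> real" where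
  "birkhoff_sum A n x = (\<Sum>k<n. A ((shift ^^ k) x))"

text \<open>\<open>splice n x y\<close> is $[x|y]_n$ and \<open>splice_at n x t y\<close> is $[x|t|y]_n$.\<close>

definition splice :: "nat \<Rightarrow> (nat \<Rightarrow> real) \<Rightarrow> (nat \<Rightarrow> real) \<Rightarrow> nat \<Rightarrow> real" where
  "splice n x y = (\<lambda>i. if i < n then x i else y i)"

definition splice_at :: "nat \<Rightarrow> (nat \<Rightarrow> real) \<Rightarrow> real \<Rightarrow> (nat \<Rightarrow> real) \<Rightarrow> nat \<Rightarrow> real" where
  "splice_at n x t y = (\<lambda>i. if i < n then x i else if i = n then t else y i)"

definition has_partial_deriv :: "((nat \<Rightarrow> real) \<Rightarrow> real) \<Rightarrow> nat \<Rightarrow> (nat \<Rightarrow> real) \<Rightarrow> bool" where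
  "has_partial_deriv A j x \<longleftrightarrow> (\<lambda>s. A (x(j := s))) differentiable (at (x j))"

definition partial_deriv :: "((nat \<Rightarrow> real) \<Rightarrow> real) \<Rightarrow> nat \<Rightarrow> (nat \<Rightarrow> real) \<Rightarrow> real" where
  "partial_deriv A j x = deriv (\<lambda>s. A (x(j := s))) (x j)"

text \<open>
  The points \<open>x(n := t)\<close> below, and all small perturbations of a single coordinate of them, lie in
  the domain $[-(1+\varepsilon), 1+\varepsilon]^{\mathbb N}$ of the extension, so its values
  outside that domain play no role and two-sided derivatives make sense.
\<close>

definition differentiable_extension ::
    "real \<Rightarrow> ((nat \<Rightarrow> real) \<Rightarrow> real) \<Rightarrow> ((nat \<Rightarrow> real) \<Rightarrow> real) \<Rightarrow> bool" where
  "differentiable_extension \<epsilon> A A' \<longleftrightarrow>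
     \<epsilon> > 0 \<and>
     (\<forall>x\<in>spin_space. A' x = A x) \<and>
     (\<forall>x\<in>cube. \<forall>j n.
        (\<forall>t\<in>{-(1 + \<epsilon>)<..<1 + \<epsilon>}. has_partial_deriv A' j (x(n := t))) \<and>
        continuous_on {-(1 + \<epsilon>)<..<1 + \<epsilon>} (\<lambda>t. partial_deriv A' j (x(n := t))))"

definition class_E_extension ::
    "real \<Rightarrow> ((nat \<Rightarrow> real) \<Rightarrow> real) \<Rightarrow> ((nat \<Rightarrow> real) \<Rightarrow> real) \<Rightarrow> bool" where
  "class_E_extension \<epsilon> A A' \<longleftrightarrow>
     differentiable_extension \<epsilon> A A' \<and>
     (\<forall>t\<in>{-1..1}. \<forall>y\<in>cube. \<forall>n\<ge>1.
        mono_on spin_space (\<lambda>x. deriv (\<lambda>s. birkhoff_sum A' n (splice_at n x s y)) t))"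

definition class_E :: "((nat \<Rightarrow> real) \<Rightarrow> real) set" where
  "class_E = {A. continuous_on spin_space A \<and> (\<exists>\<epsilon> A'. class_E_extension \<epsilon> A A')}"

definition configs :: "nat \<Rightarrow> (nat \<Rightarrow> real) set" where
  "configs n = {..<n} \<rightarrow>\<^sub>E {-1, 1}"

definition partition_function :: "((nat \<Rightarrow> real) \<Rightarrow> real) \<Rightarrow> nat \<Rightarrow> (nat \<Rightarrow> real) \<Rightarrow> real" where
  "partition_function A n y = (\<Sum>x\<in>configs n. exp (birkhoff_sum A n (splice n x y)))"

text \<open>
  A finite combination of Dirac masses, taken on the \<open>\<sigma>\<close>-algebra of all subsets so that
  every function is measurable.
\<close>

definition gibbs_measure ::
    "((nat \<Rightarrow> real) \<Rightarrow> real) \<Rightarrow> nat \<Rightarrow> (nat \<Rightarrow> real) \<Rightarrow> (nat \<Rightarrow> real) measure" where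
  "gibbs_measure A n y = measure_of UNIV UNIV (\<lambda>B. \<Sum>x\<in>configs n.
     ennreal (exp (birkhoff_sum A n (splice n x y)) / partition_function A n y) *
     emeasure (return (count_space UNIV) (splice n x y)) B)"

text \<open>
  The second sequence \<open>z\<close> ranges over all sequences, not only over \<open>spin_space\<close>: for
  a function on \<open>spin_space\<close> depending on the first \<open>n\<close> coordinates this prescribes its
  values at the points \<open>splice n x y\<close> with \<open>y \<notin> spin_space\<close>.
\<close>

definition depends_on_first :: "nat \<Rightarrow> ((nat \<Rightarrow> real) \<Rightarrow> real) \<Rightarrow> bool" where
  "depends_on_first n f \<longleftrightarrow> (\<forall>x\<in>spin_space. \<forall>z. (\<forall>i<n. z i = x i) \<longrightarrow> f z = f x)"

lemma finite_configs [simp]: "finite (configs n)"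
  unfolding configs_def by (intro finite_PiE) auto

lemma configs_nonempty [simp]: "configs n \<noteq> {}"
  unfolding configs_def by (simp add: PiE_eq_empty_iff)

lemma partition_function_pos: "partition_function A n y > 0"
  unfolding partition_function_def by (intro sum_pos) auto

lemma sets_gibbs_measure [simp]: "sets (gibbs_measure A n y) = UNIV"
  unfolding gibbs_measure_def by (auto simp: sets_measure_of_conv)

lemma space_gibbs_measure [simp]: "space (gibbs_measure A n y) = UNIV"
  unfolding gibbs_measure_def by (simp add: space_measure_of_conv)

lemma emeasure_gibbs_measure:
  "emeasure (gibbs_measure A n y) B = (\<Sum>x\<in>configs n.
     ennreal (exp (birkhoff_sum A n (splice n x y)) / partition_function A n y) *
     indicator B (splice n x y))"
proof -
  let ?w = "\<lambda>x. ennreal (exp (birkhoff_sum A n (splice n x y)) / partition_function A n y)"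
  let ?D = "\<lambda>x. return (count_space UNIV) (splice n x y)"
  have "countably_additive UNIV (\<lambda>B. \<Sum>x\<in>configs n. ?w x * emeasure (?D x) B)"
    unfolding countably_additive_def
  proof (intro allI impI)
    fix F :: "nat \<Rightarrow> (nat \<Rightarrow> real) set"
    assume F: "disjoint_family F"
    have "(\<Sum>i. \<Sum>x\<in>configs n. ?w x * emeasure (?D x) (F i)) =
        (\<Sum>x\<in>configs n. \<Sum>i. ?w x * emeasure (?D x) (F i))"
      by (rule suminf_sum) (rule summableI)
    also have "\<dots> = (\<Sum>x\<in>configs n. ?w x * emeasure (?D x) (\<Union>i. F i))"
      by (intro sum.cong refl, subst ennreal_suminf_cmult, subst suminf_emeasure) (use F in auto)
    finally show "(\<Sum>i. \<Sum>x\<in>configs n. ?w x * emeasure (?D x) (F i)) =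
        (\<Sum>x\<in>configs n. ?w x * emeasure (?D x) (\<Union>i. F i))" .
  qed
  moreover have "sigma_algebra (UNIV :: (nat \<Rightarrow> real) set) UNIV"
    using sigma_algebra_Pow[of "UNIV :: (nat \<Rightarrow> real) set"] by simp
  ultimately have "emeasure (gibbs_measure A n y) B = (\<Sum>x\<in>configs n. ?w x * emeasure (?D x) B)"
    unfolding gibbs_measure_def
    by (subst emeasure_measure_of_sigma) (auto simp: positive_def)
  then show ?thesis by simp
qed

lemma prob_space_gibbs_measure: "prob_space (gibbs_measure A n y)"
proof
  have "(\<Sum>x\<in>configs n. exp (birkhoff_sum A n (splice n x y)) / partition_function A n y) = 1"
    using partition_function_pos[of A n y]
    by (simp add: sum_divide_distrib[symmetric] partition_function_def[symmetric])
  then show "emeasure (gibbs_measure A n y) (space (gibbs_measure A n y)) = 1"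
    using partition_function_pos[of A n y] by (simp add: emeasure_gibbs_measure sum_ennreal)
qed

lemma shift_funpow: "(shift ^^ k) x = (\<lambda>i. x (k + i))"
  by (induction k) (auto simp: shift_def)

text \<open>For boundary conditions in \<open>spin_space\<close> the extension does not enter.\<close>

lemma gibbs_measure_extension:
  assumes "differentiable_extension \<epsilon> A A'" and y: "y \<in> spin_space"
  shows "gibbs_measure A' n y = gibbs_measure A n y"
proof -
  have "birkhoff_sum A' n (splice n x y) = birkhoff_sum A n (splice n x y)"
    if "x \<in> configs n" for x
  proof -
    have "(shift ^^ k) (splice n x y) \<in> spin_space" for k
      using that y by (auto simp: shift_funpow splice_def spin_space_def configs_def PiE_iff)
    then show ?thesis
      using assms(1) by (simp add: birkhoff_sum_def differentiable_extension_def)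
  qed
  then show ?thesis
    by (simp add: gibbs_measure_def partition_function_def cong: sum.cong)
qed

end

theory Submission
  imports Defs
begin

text \<open>
  Induction on $n$. Conditioned on $x_n = t$, the measure $\mu_{n+1}^y$ is $\mu_n$ with the boundary
  condition $y_n := t$, so the covariance under $\mu_{n+1}^y$ splits into the average of the
  conditional covariances, nonnegative by induction, and the covariance of the conditional means as
  functions of $t \in \{-1, 1\}$. The latter is nonnegative because the conditional means increase in
  $t$: letting $t$ vary in $[-1,1]$, the derivative of the mean of $f$ is the covariance of $f$ and
  $\frac{d}{dt} S_n(A)([x|t|y]_n)$, which is again nonnegative by induction since the latter function
  is increasing in $x$.
\<close>

section \<open>Gibbs integrals as finite weighted sums\<close>

text \<open>The Gibbs measure is the push-forward of a point measure on the finite set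
  \<open>configs n\<close>, so every integral against it is a finite sum.\<close>

lemma integral_gibbs_measure:
  fixes f :: "(nat \<Rightarrow> real) \<Rightarrow> real"
  shows "(\<integral>x. f x \<partial>gibbs_measure A n y) =
    (\<Sum>x\<in>configs n. exp (birkhoff_sum A n (splice n x y)) * f (splice n x y)) / partition_function A n y"
proof -
  let ?p = "\<lambda>x. exp (birkhoff_sum A n (splice n x y)) / partition_function A n y"
  let ?P = "point_measure (configs n) (\<lambda>x. ennreal (?p x))"
  have p: "?p x \<ge> 0" for x
    using partition_function_pos[of A n y] by simp
  have "gibbs_measure A n y = distr ?P (count_space UNIV) (\<lambda>x. splice n x y)"
  proof (rule measure_eqI)
    fix B
    have "emeasure (distr ?P (count_space UNIV) (\<lambda>x. splice n x y)) B =
        (\<Sum>x\<in>{x \<in> configs n. splice n x y \<in> B}. ennreal (?p x))"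
      by (subst emeasure_distr)
        (auto simp: measurable_point_measure_eq1 space_point_measure vimage_def Int_def conj_commute
          intro!: emeasure_point_measure_finite2)
    also have "\<dots> = emeasure (gibbs_measure A n y) B"
      unfolding emeasure_gibbs_measure
      by (subst sum.inter_filter) (simp, intro sum.cong refl, simp add: indicator_def)
    finally show "emeasure (gibbs_measure A n y) B =
        emeasure (distr ?P (count_space UNIV) (\<lambda>x. splice n x y)) B" ..
  qed simp
  then have "(\<integral>x. f x \<partial>gibbs_measure A n y) = (\<integral>x. f (splice n x y) \<partial>?P)"
    by (simp add: integral_distr measurable_point_measure_eq1)
  also have "\<dots> = (\<Sum>x\<in>configs n. ?p x * f (splice n x y))"
    using p by (simp add: lebesgue_integral_point_measure_finite)
  finally show ?thesis
    by (simp add: sum_divide_distrib)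
qed

text \<open>
  Since the test functions depend on $x_0, \dots, x_{n-1}$ only, they are evaluated at
  $[x|c]_n$ with the constant tail $c = -1$, which stays in \<open>spin_space\<close>.
\<close>

definition gibbs_sum ::
    "((nat \<Rightarrow> real) \<Rightarrow> real) \<Rightarrow> nat \<Rightarrow> (nat \<Rightarrow> real) \<Rightarrow> ((nat \<Rightarrow> real) \<Rightarrow> real) \<Rightarrow> real" where
  "gibbs_sum A n y f =
     (\<Sum>x\<in>configs n. exp (birkhoff_sum A n (splice n x y)) * f (splice n x (\<lambda>_. -1)))"

lemma gibbs_sum_one_pos: "gibbs_sum A n y (\<lambda>_. 1) > 0"
  unfolding gibbs_sum_def by (intro sum_pos) auto

lemma splice_configs_in_spin_space:
  "x \<in> configs n \<Longrightarrow> z \<in> spin_space \<Longrightarrow> splice n x z \<in> spin_space"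
  by (auto simp: splice_def configs_def spin_space_def PiE_iff)

lemma splice_upd: "splice n x (y(n := t)) = splice_at n x t y"
  by (auto simp: splice_def splice_at_def)

text \<open>Replacing the tail \<open>y\<close> by -1 leaves the first n coordinates of the argument
  of \<open>f\<close> unchanged, while the weights keep the boundary \<open>y\<close>.\<close>

lemma integral_gibbs_measure_eq_gibbs_sum:
  assumes "depends_on_first n f"
  shows "(\<integral>x. f x \<partial>gibbs_measure A n y) = gibbs_sum A n y f / gibbs_sum A n y (\<lambda>_. 1)"
proof -
  have "f (splice n x y) = f (splice n x (\<lambda>_. -1))" if "x \<in> configs n" for x
  proof -
    have "splice n x (\<lambda>_. -1) \<in> spin_space"
      using that by (rule splice_configs_in_spin_space) (simp add: spin_space_def)
    moreover have "\<forall>i<n. splice n x y i = splice n x (\<lambda>_. -1) i"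
      by (simp add: splice_def)
    ultimately show ?thesis
      using assms unfolding depends_on_first_def by blast
  qed
  then show ?thesis
    by (simp add: integral_gibbs_measure gibbs_sum_def partition_function_def cong: sum.cong)
qed

section \<open>Splitting off the last spin\<close>

lemma birkhoff_sum_Suc:
  "birkhoff_sum A (Suc n) x = birkhoff_sum A n x + A ((shift ^^ n) x)"
  by (simp add: birkhoff_sum_def)

lemma sum_configs_Suc:
  fixes h :: "(nat \<Rightarrow> real) \<Rightarrow> real"
  shows "(\<Sum>x\<in>configs (Suc n). h x) = (\<Sum>t\<in>{-1, 1}. \<Sum>x\<in>configs n. h (x(n := t)))"
proof -
  have "configs (Suc n) = (\<lambda>(t, x). x(n := t)) ` ({-1, 1} \<times> configs n)"
    by (simp add: configs_def lessThan_Suc PiE_insert_eq)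
  moreover have "inj_on (\<lambda>(t, x). x(n := t)) ({-1, 1} \<times> configs n)"
    unfolding configs_def by (rule inj_combinator) simp
  ultimately show ?thesis
    by (simp add: sum.reindex sum.cartesian_product case_prod_unfold del: sum.insert)
qed

text \<open>
  The last term of $S_{n+1}(A)([x|y]_{n+1})$ depends on $x_n$ only, so it factors out.
\<close>

lemma gibbs_sum_Suc:
  "gibbs_sum A (Suc n) y f = (\<Sum>t\<in>{-1, 1}.
     exp (A ((shift ^^ n) (y(n := t)))) * gibbs_sum A n (y(n := t)) (\<lambda>z. f (z(n := t))))"
proof -
  have 1: "splice (Suc n) (x(n := t)) z = splice n x (z(n := t))" for x z and t :: real
    by (auto simp: splice_def)
  have 2: "(splice n x z)(n := t) = splice n x (z(n := t))" for x z and t :: real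
    by (auto simp: splice_def)
  have 3: "(shift ^^ n) (splice n x z) = (shift ^^ n) z" for x z
    by (auto simp: splice_def shift_funpow)
  show ?thesis
    by (simp only: gibbs_sum_def sum_configs_Suc 1 2 birkhoff_sum_Suc 3 exp_add
        sum_distrib_left mult_ac)
qed

section \<open>Dependence of means on the boundary value \<open>y n\<close>\<close>

text \<open>After k < n shifts the moving coordinate sits at position n - k, so each summand is
  differentiable by the existence of a partial derivative of \<open>A'\<close>. The endpoints of
  [-1,1] are covered because the extension reaches beyond them.\<close>

lemma birkhoff_sum_splice_at_has_deriv:
  assumes ext: "differentiable_extension \<epsilon> A A'"
    and x: "splice n x y \<in> cube" and t: "t \<in> {-1..1}"
  shows "((\<lambda>s. birkhoff_sum A' n (splice_at n x s y)) has_real_derivative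
    deriv (\<lambda>s. birkhoff_sum A' n (splice_at n x s y)) t) (at t)"
proof -
  have "(\<lambda>s. A' ((shift ^^ k) (splice_at n x s y))) differentiable (at t)" if "k < n" for k
  proof -
    define w where "w = (shift ^^ k) (splice n x y)"
    have w: "w \<in> cube"
      using x by (auto simp: w_def shift_funpow cube_def)
    have eq: "(shift ^^ k) (splice_at n x s y) = w(n - k := s)" for s
      using that by (auto simp: w_def shift_funpow splice_at_def splice_def fun_eq_iff)
    have "has_partial_deriv A' (n - k) (w(n - k := t))"
      using ext w t by (auto simp: differentiable_extension_def)
    then show ?thesis
      by (simp add: has_partial_deriv_def eq)
  qed
  then have "(\<lambda>s. birkhoff_sum A' n (splice_at n x s y)) differentiable (at t)"
    by (auto simp: birkhoff_sum_def intro!: differentiable_sum)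
  then show ?thesis
    by (simp add: real_differentiable_def DERIV_deriv_iff_real_differentiable)
qed

text \<open>Covariance inequality cleared of denominators. All boundaries in \<open>cube\<close> are
  included because the induction moves \<open>y n\<close> through [-1,1].\<close>

definition gibbs_fkg :: "((nat \<Rightarrow> real) \<Rightarrow> real) \<Rightarrow> nat \<Rightarrow> bool" where
  "gibbs_fkg A n \<longleftrightarrow> (\<forall>y\<in>cube. \<forall>f g. mono_on spin_space f \<longrightarrow> mono_on spin_space g \<longrightarrow>
     gibbs_sum A n y f * gibbs_sum A n y g \<le>
     gibbs_sum A n y (\<lambda>x. f x * g x) * gibbs_sum A n y (\<lambda>_. 1))"

lemma cube_upd: "y \<in> cube \<Longrightarrow> t \<in> {-1..1} \<Longrightarrow> y(n := t) \<in> cube"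
  by (auto simp: cube_def)

lemma gibbs_mean_mono_boundary:
  assumes E: "class_E_extension \<epsilon> A A'" and fkg: "gibbs_fkg A' n"
    and y: "y \<in> cube" and f: "mono_on spin_space f"
  shows "gibbs_sum A' n (y(n := -1)) f / gibbs_sum A' n (y(n := -1)) (\<lambda>_. 1) \<le>
    gibbs_sum A' n (y(n := 1)) f / gibbs_sum A' n (y(n := 1)) (\<lambda>_. 1)"
proof -
  define D where "D t x = deriv (\<lambda>s. birkhoff_sum A' n (splice_at n x s y)) t" for t x
  define M where "M t h = gibbs_sum A' n (y(n := t)) h" for t h
  have ext: "differentiable_extension \<epsilon> A A'"
    using E by (simp add: class_E_extension_def)
  have D_mono: "mono_on spin_space (D t)" if "t \<in> {-1..1}" for t
  \<comment> \<open>The class condition starts at n = 1; for n = 0 the Birkhoff sum is empty and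
    \<open>D t\<close> is constant.\<close>
  proof (cases "n = 0")
    case True
    then show ?thesis
      by (auto simp: D_def birkhoff_sum_def mono_on_def)
  next
    case False
    then show ?thesis
      using E y that by (simp add: class_E_extension_def D_def[abs_def])
  qed
  \<comment> \<open>\<open>gibbs_sum\<close> evaluates its test function with tail -1; this does not
    alter \<open>D t\<close>, which reads only the first n coordinates of x.\<close>
  have D_splice: "D t (splice n x z) = D t x" for t x z
  proof -
    have "splice_at n (splice n x z) s y = splice_at n x s y" for s
      by (auto simp: splice_at_def splice_def)
    then show ?thesis
      by (simp add: D_def)
  qed
  have M_deriv: "((\<lambda>t. M t h) has_real_derivative M t (\<lambda>x. h x * D t x)) (at t)"
    if t: "t \<in> {-1..1}" for t h
  proof -
    have "((\<lambda>s. exp (birkhoff_sum A' n (splice_at n x s y))) has_real_derivative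
        exp (birkhoff_sum A' n (splice_at n x t y)) * D t x) (at t)" if "x \<in> configs n" for x
    proof -
      have "splice n x y \<in> cube"
        using that y by (force simp: splice_def configs_def cube_def PiE_iff)
      from birkhoff_sum_splice_at_has_deriv[OF ext this t] show ?thesis
        unfolding D_def by (rule DERIV_fun_exp)
    qed
    then have "((\<lambda>s. \<Sum>x\<in>configs n. exp (birkhoff_sum A' n (splice_at n x s y)) *
          h (splice n x (\<lambda>_. -1))) has_real_derivative
        (\<Sum>x\<in>configs n. exp (birkhoff_sum A' n (splice_at n x t y)) * D t x *
          h (splice n x (\<lambda>_. -1)))) (at t)"
      by (intro DERIV_sum DERIV_cmult_right)
    then show ?thesis
      by (simp add: M_def gibbs_sum_def splice_upd D_splice mult_ac)
  qed
  have pos: "M t (\<lambda>_. 1) > 0" for t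
    by (simp add: M_def gibbs_sum_one_pos)
  have "M (-1) f / M (-1) (\<lambda>_. 1) \<le> M 1 f / M 1 (\<lambda>_. 1)"
  proof (rule DERIV_nonneg_imp_nondecreasing[where f = "\<lambda>t. M t f / M t (\<lambda>_. 1)"])
    fix t :: real
    assume "-1 \<le> t" "t \<le> 1"
    then have t: "t \<in> {-1..1}" by simp
    \<comment> \<open>Quotient rule: this is the covariance of \<open>f\<close> and
      \<open>D t\<close> under the boundary \<open>y(n := t)\<close>.\<close>
    let ?d = "(M t (\<lambda>x. f x * D t x) * M t (\<lambda>_. 1) - M t f * M t (D t)) / (M t (\<lambda>_. 1) * M t (\<lambda>_. 1))"
    have "((\<lambda>t. M t f / M t (\<lambda>_. 1)) has_real_derivative ?d) (at t)"
      using DERIV_divide[OF M_deriv[OF t, of f] M_deriv[OF t, of "\<lambda>_. 1"]] pos[of t] by simp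
    moreover have "?d \<ge> 0"
      using fkg f D_mono[OF t] cube_upd[OF y t]
      by (intro divide_nonneg_nonneg) (auto simp: gibbs_fkg_def M_def)
    ultimately show "\<exists>d. ((\<lambda>t. M t f / M t (\<lambda>_. 1)) has_real_derivative d) (at t) \<and> 0 \<le> d"
      by blast
  qed simp
  then show ?thesis
    by (simp add: M_def)
qed

section \<open>Conditioning on the last spin\<close>

text \<open>Total covariance over two events of weights a and b: the covariance of the conditional
  means contributes \<open>a * b * (F1 - F0) * (G1 - G0)\<close>.\<close>

lemma two_point_chebyshev:
  fixes a b :: real
  assumes "a \<ge> 0" "b \<ge> 0" "F0 \<le> F1" "G0 \<le> G1" "F0 * G0 \<le> H0" "F1 * G1 \<le> H1"
  shows "(a * F0 + b * F1) * (a * G0 + b * G1) \<le> (a * H0 + b * H1) * (a + b)"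
proof -
  have "0 \<le> a * b * ((F1 - F0) * (G1 - G0))"
    using assms by simp
  then have "(a * F0 + b * F1) * (a * G0 + b * G1) \<le> (a * (F0 * G0) + b * (F1 * G1)) * (a + b)"
    by (simp add: algebra_simps)
  also have "\<dots> \<le> (a * H0 + b * H1) * (a + b)"
    using assms by (intro mult_right_mono add_mono mult_left_mono) auto
  finally show ?thesis .
qed

lemma gibbs_fkg_Suc:
  assumes E: "class_E_extension \<epsilon> A A'" and fkg: "gibbs_fkg A' n"
  shows "gibbs_fkg A' (Suc n)"
  unfolding gibbs_fkg_def
proof (intro ballI allI impI)
  fix y and f g :: "(nat \<Rightarrow> real) \<Rightarrow> real"
  assume y: "y \<in> cube" and f: "mono_on spin_space f" and g: "mono_on spin_space g"
  define M where "M t h = gibbs_sum A' n (y(n := t)) h" for t h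
  \<comment> \<open>\<open>m t h\<close> is the conditional mean of \<open>h\<close> given that the
    last spin is t, and \<open>a t\<close> is the unnormalised weight of that event.\<close>
  define m where "m t h = M t (\<lambda>z. h (z(n := t))) / M t (\<lambda>_. 1)" for t h
  define a where "a t = exp (A' ((shift ^^ n) (y(n := t)))) * M t (\<lambda>_. 1)" for t
  have pos: "M t (\<lambda>_. 1) > 0" for t
    by (simp add: M_def gibbs_sum_one_pos)
  have upd_mono: "mono_on spin_space (\<lambda>z. h (z(n := t)))"
    if "mono_on spin_space h" "t \<in> {-1, 1}" for h :: "(nat \<Rightarrow> real) \<Rightarrow> real" and t
    using that by (auto simp: mono_on_def spin_space_def le_fun_def)
  have mean_mono: "m (-1) h \<le> m 1 h" if h: "mono_on spin_space h" for h
  proof -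
    \<comment> \<open>Flipping the last spin changes both integrand and measure. The integrand is
      raised here under a fixed measure; the boundary of the measure is then moved with the
      integrand held at spin -1.\<close>
    have "gibbs_sum A' n z (\<lambda>x. h (x(n := -1))) \<le> gibbs_sum A' n z (\<lambda>x. h (x(n := 1)))" for z
      unfolding gibbs_sum_def
    proof (intro sum_mono mult_left_mono)
      fix x
      assume "x \<in> configs n"
      then have "splice n x (\<lambda>_. -1) \<in> spin_space"
        by (rule splice_configs_in_spin_space) (simp add: spin_space_def)
      then show "h ((splice n x (\<lambda>_. -1))(n := -1)) \<le> h ((splice n x (\<lambda>_. -1))(n := 1))"
        by (intro mono_onD[OF h]) (auto simp: spin_space_def le_fun_def)
    qed simp
    then have "M 1 (\<lambda>x. h (x(n := -1))) / M 1 (\<lambda>_. 1) \<le> m 1 h"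
      unfolding m_def M_def by (intro divide_right_mono less_imp_le[OF gibbs_sum_one_pos])
    moreover have "m (-1) h \<le> M 1 (\<lambda>x. h (x(n := -1))) / M 1 (\<lambda>_. 1)"
      unfolding m_def M_def by (intro gibbs_mean_mono_boundary[OF E fkg y] upd_mono h) simp
    ultimately show ?thesis by linarith
  qed
  have cond: "m t f * m t g \<le> m t (\<lambda>x. f x * g x)" if t: "t \<in> {-1, 1}" for t
  proof -
    have "y(n := t) \<in> cube"
      using t by (intro cube_upd y) auto
    then have "M t (\<lambda>z. f (z(n := t))) * M t (\<lambda>z. g (z(n := t))) \<le>
        M t (\<lambda>z. f (z(n := t)) * g (z(n := t))) * M t (\<lambda>_. 1)"
      using fkg upd_mono[OF f t] upd_mono[OF g t] by (simp add: gibbs_fkg_def M_def)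
    then show ?thesis
      using pos[of t] by (simp add: m_def divide_simps mult.assoc)
  qed
  have total: "gibbs_sum A' (Suc n) y h = a (-1) * m (-1) h + a 1 * m 1 h" for h
    using pos[of 1] pos[of "-1"] by (simp add: gibbs_sum_Suc a_def m_def M_def)
  have m_one: "m t (\<lambda>_. 1) = 1" for t
    using pos[of t] by (simp add: m_def)
  have "a t \<ge> 0" for t
    using pos[of t] by (simp add: a_def)
  then show "gibbs_sum A' (Suc n) y f * gibbs_sum A' (Suc n) y g \<le>
      gibbs_sum A' (Suc n) y (\<lambda>x. f x * g x) * gibbs_sum A' (Suc n) y (\<lambda>_. 1)"
    unfolding total m_one mult_1_right
    by (intro two_point_chebyshev mean_mono f g cond) auto
qed

section \<open>Induction and conclusion\<close>

lemma class_E_gibbs_fkg: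
  assumes "class_E_extension \<epsilon> A A'"
  shows "gibbs_fkg A' n"
proof (induction n)
  case 0
  \<comment> \<open>\<open>configs 0\<close> is a singleton, so equality holds.\<close>
  show ?case
    by (simp add: gibbs_fkg_def gibbs_sum_def configs_def)
next
  case (Suc n)
  then show ?case
    by (rule gibbs_fkg_Suc[OF assms])
qed

theorem theorem1:
  fixes A A' :: "(nat \<Rightarrow> real) \<Rightarrow> real" and \<epsilon> :: real and y :: "nat \<Rightarrow> real" and n :: nat
  assumes "A \<in> class_E"
    and "class_E_extension \<epsilon> A A'"
    and "y \<in> cube"
    and "n \<ge> 1"
  shows "prob_space (gibbs_measure A' n y) \<and>
    (\<forall>f g. mono_on spin_space f \<and> mono_on spin_space g \<and>
            depends_on_first n f \<and> depends_on_first n g \<longrightarrow>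
       (\<integral>x. f x * g x \<partial>gibbs_measure A' n y)
         - (\<integral>x. f x \<partial>gibbs_measure A' n y) * (\<integral>x. g x \<partial>gibbs_measure A' n y) \<ge> 0)"
proof (rule conjI[OF prob_space_gibbs_measure], intro allI impI)
  fix f g :: "(nat \<Rightarrow> real) \<Rightarrow> real"
  assume "mono_on spin_space f \<and> mono_on spin_space g \<and>
    depends_on_first n f \<and> depends_on_first n g"
  then have mono: "mono_on spin_space f" "mono_on spin_space g"
    and dep: "depends_on_first n f" "depends_on_first n g"
    by simp_all
  have dep': "depends_on_first n (\<lambda>x. f x * g x)"
    using dep unfolding depends_on_first_def by metis
  \<comment> \<open>Dividing by the square of the normaliser turns this into the covariance
    inequality.\<close>
  have "gibbs_sum A' n y f * gibbs_sum A' n y g \<le>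
      gibbs_sum A' n y (\<lambda>x. f x * g x) * gibbs_sum A' n y (\<lambda>_. 1)"
    using class_E_gibbs_fkg[OF assms(2)] assms(3) mono by (simp add: gibbs_fkg_def)
  then show "0 \<le> (\<integral>x. f x * g x \<partial>gibbs_measure A' n y)
      - (\<integral>x. f x \<partial>gibbs_measure A' n y) * (\<integral>x. g x \<partial>gibbs_measure A' n y)"
    unfolding integral_gibbs_measure_eq_gibbs_sum[OF dep(1)]
      integral_gibbs_measure_eq_gibbs_sum[OF dep(2)] integral_gibbs_measure_eq_gibbs_sum[OF dep']
    using gibbs_sum_one_pos[of A' n y] by (simp add: divide_simps mult.assoc)
qed

end
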